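(* In the source detection game with consistent source behavior on known static graphs, with one watched node per round, there is a Discoverer algorithm that wins the game while tolerating, in expectation, $O(\mathrm{tw}\cdot n\log n)$ infections. Here $n$ is the number of nodes and $\mathrm{tw}$ is the treewidth of the underlying static graph.
   Context: A temporal graph $\mathcal{G}=(V,E,\lambda)$ with lifetime $T_{\max}$ consists of a finite simple undirected graph $(V,E)$, called the underlying static graph, together with a labeling $\lambda\colon E\to\{1,\dots,T_{\max}\}$. The edge $e$ is present only at time $\lambda(e)$. Write $n=|V|$. Infections follow the SIR model with duration $\delta\ge1$. A node may be seed-infected at some time. A susceptible node $u$ becomes infected at time $t$ iff some neighbor $v$ is infectious at time $t$ and $\lambda(uv)=t$; exactly one such neighbor counts as its infector. The node $u$ is then infectious at times $t+1,\dots,t+\delta$ and resistant afterwards. SD game: an Adversary fixes the temporal graph, $T_{\max}$, $\delta$, and a source node $s$. The Discoverer is told $V$, $E$ (known static graph), $T_{\max}$ and $\delta$, but not $\lambda$. In each round the Discoverer watches one node. All nodes start susceptible, the source is seed-infected, and an infection chain unfolds. The Discoverer learns whether, when, and by which neighbor the watched node was infected (or that it was the seed). Consistent source behavior means the same seed time and the same infection chain are used in every round. The Discoverer eventually names a node and wins iff it is $s$. The number of tolerated infections (price of detection) is the total number of nodes infected, summed over all rounds, until the Discoverer stops.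
   Formalization: The factor tw is replaced by max(1, tw): for edgeless graphs with at least two nodes tw = 0, and the literal bound of 0 infections cannot be achieved; for every graph with an edge the bound is unchanged. *)

theory Defs
  imports "HOL-Probability.Probability"
begin

section \<open>Static graphs and treewidth\<close>

definition simple_graph :: "'a set \<Rightarrow> 'a set set \<Rightarrow> bool" where
  "simple_graph V E \<longleftrightarrow> finite V \<and> (\<forall>e\<in>E. e \<subseteq> V \<and> card e = 2)"

definition connected_graph :: "'a set \<Rightarrow> 'a set set \<Rightarrow> bool" where
  "connected_graph V E \<longleftrightarrow> V \<noteq> {} \<and> (\<forall>u\<in>V. \<forall>v\<in>V. (u, v) \<in> {(x, y). {x, y} \<in> E}\<^sup>*)"

definition induced_edges :: "'a set set \<Rightarrow> 'a set \<Rightarrow> 'a set set" where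
  "induced_edges E S = {e \<in> E. e \<subseteq> S}"

definition is_cycle :: "'a set set \<Rightarrow> 'a list \<Rightarrow> bool" where
  "is_cycle E p \<longleftrightarrow> length p \<ge> 3 \<and> distinct p \<and>
     (\<forall>i<length p. {p ! i, p ! (Suc i mod length p)} \<in> E)"

definition is_tree :: "'a set \<Rightarrow> 'a set set \<Rightarrow> bool" where
  "is_tree V E \<longleftrightarrow> simple_graph V E \<and> connected_graph V E \<and> (\<nexists>p. is_cycle E p)"

definition tree_decomposition ::
  "'a set \<Rightarrow> 'a set set \<Rightarrow> nat set \<Rightarrow> nat set set \<Rightarrow> (nat \<Rightarrow> 'a set) \<Rightarrow> bool" where
  "tree_decomposition V E I F bag \<longleftrightarrow>
     is_tree I F \<and>
     (\<Union>i\<in>I. bag i) = V \<and>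
     (\<forall>e\<in>E. \<exists>i\<in>I. e \<subseteq> bag i) \<and>
     (\<forall>v\<in>V. connected_graph {i \<in> I. v \<in> bag i} (induced_edges F {i \<in> I. v \<in> bag i}))"

definition decomposition_width :: "nat set \<Rightarrow> (nat \<Rightarrow> 'a set) \<Rightarrow> nat" where
  "decomposition_width I bag = Max ((\<lambda>i. card (bag i)) ` I) - 1"

definition treewidth :: "'a set \<Rightarrow> 'a set set \<Rightarrow> nat" where
  "treewidth V E =
     (LEAST w. \<exists>I F bag. tree_decomposition V E I F bag \<and> decomposition_width I bag = w)"


section \<open>Temporal graphs and SIR infection chains\<close>

definition temporal_graph :: "'a set \<Rightarrow> 'a set set \<Rightarrow> ('a set \<Rightarrow> nat) \<Rightarrow> nat \<Rightarrow> bool" where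
  "temporal_graph V E lab Tmax \<longleftrightarrow> simple_graph V E \<and> (\<forall>e\<in>E. lab e \<in> {1..Tmax})"

text \<open>What happens to a node during a round: it stays uninfected, is seed-infected at a time,
  or is infected at a time by a neighbour. This is also exactly what watching it reveals, so an
  infection chain is represented as the map from nodes to their fates.\<close>

datatype 'a fate = Uninfected | Seeded nat | Infected nat 'a

definition infected_at :: "('a \<Rightarrow> 'a fate) \<Rightarrow> 'a \<Rightarrow> nat \<Rightarrow> bool" where
  "infected_at c u t \<longleftrightarrow> c u = Seeded t \<or> (\<exists>v. c u = Infected t v)"

definition susceptible :: "('a \<Rightarrow> 'a fate) \<Rightarrow> 'a \<Rightarrow> nat \<Rightarrow> bool" where
  "susceptible c u t \<longleftrightarrow> (\<forall>t'<t. \<not> infected_at c u t')"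

definition infectious :: "nat \<Rightarrow> ('a \<Rightarrow> 'a fate) \<Rightarrow> 'a \<Rightarrow> nat \<Rightarrow> bool" where
  "infectious \<delta> c v t \<longleftrightarrow> (\<exists>t'. infected_at c v t' \<and> t \<in> {t' + 1..t' + \<delta>})"

definition transmits ::
  "'a set set \<Rightarrow> ('a set \<Rightarrow> nat) \<Rightarrow> nat \<Rightarrow> ('a \<Rightarrow> 'a fate) \<Rightarrow> 'a \<Rightarrow> 'a \<Rightarrow> nat \<Rightarrow> bool" where
  "transmits E lab \<delta> c v u t \<longleftrightarrow> {u, v} \<in> E \<and> lab {u, v} = t \<and> infectious \<delta> c v t"

text \<open>The chains that may unfold when \<open>s\<close> alone is seed-infected, at time \<open>t0\<close>. The first condition
  determines all infection times (by recursion on time); only the choice of the infector among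
  several simultaneous candidates is left open.\<close>

definition infection_chain ::
  "'a set set \<Rightarrow> ('a set \<Rightarrow> nat) \<Rightarrow> nat \<Rightarrow> 'a \<Rightarrow> nat \<Rightarrow> ('a \<Rightarrow> 'a fate) \<Rightarrow> bool" where
  "infection_chain E lab \<delta> s t0 c \<longleftrightarrow>
     (\<forall>u t. infected_at c u t \<longleftrightarrow>
        susceptible c u t \<and> (u = s \<and> t = t0 \<or> (\<exists>v. transmits E lab \<delta> c v u t))) \<and>
     (\<forall>u t. c u = Seeded t \<longleftrightarrow> u = s \<and> t = t0) \<and>
     (\<forall>u t v. c u = Infected t v \<longrightarrow> transmits E lab \<delta> c v u t)"

definition infected_nodes :: "'a set \<Rightarrow> ('a \<Rightarrow> 'a fate) \<Rightarrow> 'a set" where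
  "infected_nodes V c = {u \<in> V. c u \<noteq> Uninfected}"


section \<open>The source detection game\<close>

datatype 'a action = Watch 'a | Name 'a

text \<open>A deterministic strategy maps the nodes watched so far, with what was observed, to the next
  action. A randomized Discoverer is a probability distribution on deterministic strategies.\<close>

type_synonym 'a strategy = "('a \<times> 'a fate) list \<Rightarrow> 'a action"

definition legal_strategy :: "'a set \<Rightarrow> 'a strategy \<Rightarrow> bool" where
  "legal_strategy V \<sigma> \<longleftrightarrow> (\<forall>h. \<sigma> h \<in> Watch ` V \<union> Name ` V)"

text \<open>The history after \<open>r\<close> rounds; it stays constant once a node has been named. Consistent source
  behaviour is reflected in the same chain \<open>c\<close> being used in every round.\<close>

primrec history :: "('a \<Rightarrow> 'a fate) \<Rightarrow> 'a strategy \<Rightarrow> nat \<Rightarrow> ('a \<times> 'a fate) list" where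
  "history c \<sigma> 0 = []"
| "history c \<sigma> (Suc r) =
     (case \<sigma> (history c \<sigma> r) of
        Watch v \<Rightarrow> history c \<sigma> r @ [(v, c v)]
      | Name v \<Rightarrow> history c \<sigma> r)"

definition wins :: "('a \<Rightarrow> 'a fate) \<Rightarrow> 'a \<Rightarrow> 'a strategy \<Rightarrow> bool" where
  "wins c s \<sigma> \<longleftrightarrow> (\<exists>r. \<sigma> (history c \<sigma> r) = Name s)"

text \<open>The sum ranges over the rounds actually played, and is infinite if the Discoverer never stops.\<close>

definition tolerated_infections ::
  "'a set \<Rightarrow> ('a \<Rightarrow> 'a fate) \<Rightarrow> 'a strategy \<Rightarrow> ennreal" where
  "tolerated_infections V c \<sigma> =
     (\<Sum>r. if \<exists>v. \<sigma> (history c \<sigma> r) = Watch v then of_nat (card (infected_nodes V c)) else 0)"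

end

theory Submission
  imports Defs
begin

text \<open>If \<open>k\<close> of the \<open>n\<close> nodes get infected, watching uniformly random nodes hits an infected node
  \<open>w\<close> after \<open>n / k\<close> rounds in expectation, which costs about \<open>n\<close> infections. From then on a set \<open>C\<close> of
  candidates is halved repeatedly. Some bag \<open>S\<close> of an optimal tree decomposition leaves at most half
  of \<open>C\<close> in every component of \<open>G - S\<close>; watch all of \<open>S\<close>. If some node of \<open>S\<close> is infected, consider
  the earliest one: it is the source, or the infection reached its infector without
  meeting \<open>S\<close>, so the source lies in the component of that infector. If \<open>S\<close> stays uninfected, the
  source lies in the component of \<open>w\<close>. This phase takes \<open>O(tw log n)\<close> rounds of at most \<open>n\<close> infections.\<close>

section \<open>Balanced separators from tree decompositions\<close>

definition reach :: "'a set set \<Rightarrow> 'a set \<Rightarrow> ('a \<times> 'a) set" where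
  "reach E S = {(x, y). {x, y} \<in> E \<and> x \<notin> S \<and> y \<notin> S}\<^sup>*"

lemma reach_refl [simp]: "(x, x) \<in> reach E S"
  by (simp add: reach_def)

lemma reach_edge: "{x, y} \<in> E \<Longrightarrow> x \<notin> S \<Longrightarrow> y \<notin> S \<Longrightarrow> (x, y) \<in> reach E S"
  by (auto simp: reach_def)

lemma reach_trans: "(x, y) \<in> reach E S \<Longrightarrow> (y, z) \<in> reach E S \<Longrightarrow> (x, z) \<in> reach E S"
  by (auto simp: reach_def)

lemma reach_sym: "(x, y) \<in> reach E S \<Longrightarrow> (y, x) \<in> reach E S"
  unfolding reach_def
  by (rule symD[OF sym_rtrancl]) (auto simp: sym_def insert_commute)

lemma reach_mono:
  assumes "\<And>x y. {x, y} \<in> E \<Longrightarrow> x \<notin> S \<Longrightarrow> y \<notin> S \<Longrightarrow> {x, y} \<in> E' \<and> x \<notin> S' \<and> y \<notin> S'"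
  shows "reach E S \<subseteq> reach E' S'"
  unfolding reach_def by (rule rtrancl_mono) (use assms in auto)

lemma reach_notin: "(x, y) \<in> reach E S \<Longrightarrow> x \<notin> S \<Longrightarrow> y \<notin> S"
  unfolding reach_def by (induction rule: rtrancl_induct) auto

lemma shortest_walk:
  assumes "(x, y) \<in> r\<^sup>*"
  obtains g :: "nat \<Rightarrow> 'a" and n where "g 0 = x" "g n = y"
    "\<And>i. i < n \<Longrightarrow> (g i, g (Suc i)) \<in> r" "inj_on g {..n}"
proof -
  define n where "n = (LEAST n. (x, y) \<in> r ^^ n)"
  have "(x, y) \<in> r ^^ n"
    unfolding n_def using assms by (auto simp: rtrancl_power intro: LeastI)
  then obtain g where g: "g 0 = x" "g n = y" "\<And>i. i < n \<Longrightarrow> (g i, g (Suc i)) \<in> r"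
    by (auto simp: relpow_fun_conv)
  have walk: "(g a, g (a + k)) \<in> r ^^ k" if "a + k \<le> n" for a k
    using that by (induction k) (auto intro!: g(3) relcompI)
  have "g a \<noteq> g b" if "a < b" "b \<le> n" for a b
  proof
    assume eq: "g a = g b"
    have "(x, g a) \<in> r ^^ a" using walk[of 0 a] that g by simp
    moreover have "(g b, y) \<in> r ^^ (n - b)" using walk[of b "n - b"] that g by simp
    ultimately have "(x, y) \<in> r ^^ (a + (n - b))" using eq by (auto simp: relpow_add)
    then have "n \<le> a + (n - b)" unfolding n_def by (rule Least_le)
    then show False using that by simp
  qed
  then have "inj_on g {..n}"
    by (intro inj_onI) (metis atMost_iff linorder_neqE_nat)
  with g that show ?thesis by blast
qed

lemma is_cycle_of_fun:
  assumes "n \<ge> 3" "inj_on g {..<n}" "\<And>i. Suc i < n \<Longrightarrow> {g i, g (Suc i)} \<in> E" "{g (n - 1), g 0} \<in> E"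
  shows "is_cycle E (map g [0..<n])"
  unfolding is_cycle_def
proof (intro conjI allI impI)
  show "distinct (map g [0..<n])"
    using assms(2) by (simp add: distinct_map atLeast0LessThan)
  fix i assume i: "i < length (map g [0..<n])"
  show "{map g [0..<n] ! i, map g [0..<n] ! (Suc i mod length (map g [0..<n]))} \<in> E"
  proof (cases "Suc i = n")
    case True
    then show ?thesis using assms(4) i by auto
  next
    case False
    then show ?thesis using assms(3) i by auto
  qed
qed (use assms in auto)

lemma acyclic_edge_is_bridge:
  assumes "\<nexists>p. is_cycle F p" "{i, j} \<in> F" "i \<noteq> j"
    and "(x, j) \<in> reach F {i}" "(x, i) \<in> reach F {j}"
  shows False
proof -
  let ?F = "F - {{i, j}}"
  have "reach F {k} \<subseteq> reach ?F {}" if "k \<in> {i, j}" for k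
    by (rule reach_mono) (use that in \<open>auto simp: doubleton_eq_iff\<close>)
  then have "(x, j) \<in> reach ?F {}" "(x, i) \<in> reach ?F {}"
    using assms(4,5) by blast+
  then have "(i, j) \<in> reach ?F {}"
    using reach_trans[OF reach_sym] by fast
  then obtain g n where g: "g 0 = i" "g n = j" "\<And>k. k < n \<Longrightarrow> {g k, g (Suc k)} \<in> ?F"
    and inj: "inj_on g {..n}"
    unfolding reach_def by (elim shortest_walk) auto
  have "n \<noteq> 0" using g assms(3) by (metis)
  moreover have "n \<noteq> 1" using g(1,2) g(3)[of 0] by auto
  ultimately have "Suc n \<ge> 3" by simp
  then have "is_cycle F (map g [0..<Suc n])"
    by (rule is_cycle_of_fun) (use g inj assms(2) in \<open>auto simp: lessThan_Suc_atMost insert_commute\<close>)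
  with assms(1) show False by blast
qed

lemma acyclic_neighbour_map_has_two_cycle:
  assumes "finite I" "I \<noteq> {}" "\<nexists>p. is_cycle F p"
    and f: "\<And>i. i \<in> I \<Longrightarrow> f i \<in> I \<and> f i \<noteq> i \<and> {i, f i} \<in> F"
  obtains i where "i \<in> I" "f (f i) = i"
proof -
  obtain i0 where i0: "i0 \<in> I" using assms(2) by blast
  define g where "g n = (f ^^ n) i0" for n
  have gI: "g n \<in> I" for n
    unfolding g_def by (induction n) (use i0 f in auto)
  have gS: "g (Suc n) = f (g n)" for n by (simp add: g_def)
  have "\<not> inj g"
    using gI assms(1) by (meson finite_imageD finite_subset image_subsetI infinite_UNIV_nat)
  then obtain b b' where "b < b'" "g b = g b'"
    unfolding inj_def by (metis nat_neq_iff)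
  then have "b' - b > 0 \<and> (\<exists>a. g (a + (b' - b)) = g a)"
    by (intro conjI exI[of _ b]) auto
  then have ex: "\<exists>p. p > 0 \<and> (\<exists>a. g (a + p) = g a)" by blast
  define p where "p = (LEAST p. p > 0 \<and> (\<exists>a. g (a + p) = g a))"
  have p: "p > 0" "\<exists>a. g (a + p) = g a"
    using LeastI_ex[OF ex] unfolding p_def by auto
  have pmin: "p \<le> q" if "q > 0" "g (a + q) = g a" for q a
    unfolding p_def by (rule Least_le) (use that in blast)
  obtain a where a: "g (a + p) = g a" using p by blast
  define h where "h n = g (a + n)" for n
  have "h x \<noteq> h y" if "x < y" "y < p" for x y
    using pmin[of "y - x" "a + x"] that unfolding h_def by auto
  then have inj: "inj_on h {..<p}"
    by (intro inj_onI) (metis lessThan_iff linorder_neqE_nat)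
  have hS: "{h k, h (Suc k)} \<in> F" for k
    using f[OF gI[of "a + k"]] by (simp add: h_def gS)
  have "\<not> p \<ge> 3"
  proof
    assume "p \<ge> 3"
    then have "is_cycle F (map h [0..<p])"
      using inj hS hS[of "p - 1"] p(1) a by (intro is_cycle_of_fun) (auto simp: h_def)
    then show False using assms(3) by blast
  qed
  moreover have "p \<noteq> 1"
    using a f[OF gI[of a]] by (auto simp: gS)
  ultimately have "p = 2" using p(1) by linarith
  then have "f (f (g a)) = g a" using a by (simp add: gS)
  with gI that show ?thesis by blast
qed

text \<open>If every bag left a component carrying more than half of \<open>C\<close>, pointing each tree node towards
  its heavy component would make two adjacent tree nodes point at each other; their heavy
  components lie on different sides of the edge, yet together exceed \<open>C\<close>.\<close>

lemma balanced_bag: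
  assumes sg: "simple_graph V E" and td: "tree_decomposition V E I F bag" and CV: "C \<subseteq> V"
  obtains i where "i \<in> I" "\<And>y. y \<notin> bag i \<Longrightarrow> 2 * card (C \<inter> reach E (bag i) `` {y}) \<le> card C"
proof -
  have tree: "simple_graph I F" "connected_graph I F" and acyc: "\<nexists>p. is_cycle F p"
    and bags: "(\<Union>i\<in>I. bag i) = V" "\<And>e. e \<in> E \<Longrightarrow> \<exists>i\<in>I. e \<subseteq> bag i"
    and conn: "\<And>v. v \<in> V \<Longrightarrow> connected_graph {i \<in> I. v \<in> bag i} (induced_edges F {i \<in> I. v \<in> bag i})"
    using td unfolding tree_decomposition_def is_tree_def by blast+
  have FI: "x \<in> I \<and> y \<in> I \<and> x \<noteq> y" if "{x, y} \<in> F" for x y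
    using tree(1) that unfolding simple_graph_def by fastforce
  have EV: "x \<in> V \<and> y \<in> V" if "{x, y} \<in> E" for x y
    using sg that unfolding simple_graph_def by fastforce
  have finI: "finite I" and neI: "I \<noteq> {}"
    using tree unfolding simple_graph_def connected_graph_def by auto
  have finC: "finite C"
    using sg CV unfolding simple_graph_def by (meson finite_subset)
  have bag_conn: "(x, x') \<in> reach F {i}"
    if "v \<in> V" "v \<notin> bag i" "x \<in> I" "v \<in> bag x" "x' \<in> I" "v \<in> bag x'" for v i x x'
  proof -
    let ?J = "{i \<in> I. v \<in> bag i}"
    have "(x, x') \<in> reach (induced_edges F ?J) {}"
      using conn[OF that(1)] that unfolding connected_graph_def reach_def by auto
    also have "reach (induced_edges F ?J) {} \<subseteq> reach F {i}"
      by (rule reach_mono) (use that in \<open>auto simp: induced_edges_def\<close>)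
    finally show ?thesis .
  qed
  have comp_conn: "(x, x') \<in> reach F {i}"
    if "(u, v) \<in> reach E (bag i)" "u \<in> V" "u \<notin> bag i" "x \<in> I" "u \<in> bag x" "x' \<in> I" "v \<in> bag x'"
    for u v i x x'
    using that(1,6,7) unfolding reach_def[of E]
  proof (induction arbitrary: x' rule: rtrancl_induct)
    case base
    then show ?case using bag_conn that by blast
  next
    case (step y z)
    then obtain b where "b \<in> I" "y \<in> bag b" "z \<in> bag b" using bags(2)[of "{y, z}"] by auto
    moreover have "z \<in> V" using step EV by auto
    ultimately show ?case
      using step bag_conn[of z i b x'] reach_trans[of x b] by blast
  qed
  show ?thesis
  proof (rule ccontr)
    assume "\<not> thesis"
    then have "\<forall>i\<in>I. \<exists>y. y \<notin> bag i \<and> 2 * card (C \<inter> reach E (bag i) `` {y}) > card C"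
      using that by (meson not_le)
    then obtain h where h: "\<And>i. i \<in> I \<Longrightarrow> h i \<notin> bag i"
      and heavy: "\<And>i. i \<in> I \<Longrightarrow> 2 * card (C \<inter> reach E (bag i) `` {h i}) > card C"
      by metis
    let ?K = "\<lambda>i. C \<inter> reach E (bag i) `` {h i}"
    have "\<exists>j. {i, j} \<in> F \<and> (\<forall>v\<in>?K i. \<forall>x\<in>I. v \<in> bag x \<longrightarrow> (x, j) \<in> reach F {i})" if i: "i \<in> I" for i
    proof -
      have "?K i \<noteq> {}" using heavy[OF i] by (intro notI) simp
      then obtain v0 where v0: "v0 \<in> ?K i" by blast
      then have v0V: "v0 \<in> V" and v0n: "v0 \<notin> bag i"
        using CV h[OF i] reach_notin[of "h i" v0 E "bag i"] by auto
      obtain x0 where x0: "x0 \<in> I" "v0 \<in> bag x0" using v0V bags(1) by auto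
      have "(x0, i) \<in> {(x, y). {x, y} \<in> F}\<^sup>*"
        using tree(2) x0 i unfolding connected_graph_def by blast
      then have "x0 = i \<or> (\<exists>j. {i, j} \<in> F \<and> (x0, j) \<in> reach F {i})"
      proof (induction rule: converse_rtrancl_induct)
        case (step y z)
        show ?case
        proof (cases "y = i \<or> z = i")
          case True
          then show ?thesis using step.hyps(1) by (auto simp: insert_commute)
        next
          case False
          then have "(y, z) \<in> reach F {i}" using step.hyps(1) by (auto intro: reach_edge)
          then show ?thesis using step.IH False reach_trans[of y z F "{i}"] by auto
        qed
      qed simp
      moreover have "x0 \<noteq> i" using x0 v0n by auto
      ultimately obtain j where j: "{i, j} \<in> F" "(x0, j) \<in> reach F {i}" by blast
      have "(x, j) \<in> reach F {i}" if "v \<in> ?K i" "x \<in> I" "v \<in> bag x" for v x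
      proof -
        have "(v0, v) \<in> reach E (bag i)" using v0 that(1) reach_sym reach_trans by fastforce
        then have "(x0, x) \<in> reach F {i}" using comp_conn v0V v0n x0 that by blast
        then show ?thesis using j reach_sym reach_trans by metis
      qed
      then show ?thesis using j(1) by blast
    qed
    then have "\<exists>f. \<forall>i\<in>I. {i, f i} \<in> F \<and> (\<forall>v\<in>?K i. \<forall>x\<in>I. v \<in> bag x \<longrightarrow> (x, f i) \<in> reach F {i})"
      by (intro bchoice) blast
    then obtain f where f: "\<And>i. i \<in> I \<Longrightarrow> {i, f i} \<in> F"
      and side: "\<And>i v x. i \<in> I \<Longrightarrow> v \<in> ?K i \<Longrightarrow> x \<in> I \<Longrightarrow> v \<in> bag x \<Longrightarrow> (x, f i) \<in> reach F {i}"
      by blast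
    have "f i \<in> I \<and> f i \<noteq> i \<and> {i, f i} \<in> F" if "i \<in> I" for i
      using f[OF that] FI[of i "f i"] by auto
    with acyclic_neighbour_map_has_two_cycle[OF finI neI acyc]
    obtain i where i: "i \<in> I" "f (f i) = i" by blast
    have fi: "f i \<in> I" "f i \<noteq> i" using FI[OF f[OF i(1)]] by auto
    have "?K i \<inter> ?K (f i) \<noteq> {}"
    proof
      assume "?K i \<inter> ?K (f i) = {}"
      then have "card (?K i) + card (?K (f i)) = card (?K i \<union> ?K (f i))"
        using finC by (subst card_Un_disjoint) auto
      also have "\<dots> \<le> card C" using finC by (intro card_mono) auto
      finally show False using heavy[OF i(1)] heavy[OF fi(1)] by linarith
    qed
    then obtain v where v: "v \<in> ?K i" "v \<in> ?K (f i)" by blast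
    then obtain x where x: "x \<in> I" "v \<in> bag x" using CV bags(1) by blast
    show False
      using acyclic_edge_is_bridge[OF acyc f[OF i(1)] fi(2)[symmetric]]
        side[OF i(1) v(1) x] side[OF fi(1) v(2) x] i(2) by simp
  qed
qed

lemma treewidth_decomposition:
  assumes "simple_graph V E" "V \<noteq> {}"
  obtains I F bag where "tree_decomposition V E I F bag" "\<And>i. i \<in> I \<Longrightarrow> card (bag i) \<le> treewidth V E + 1"
proof -
  have "is_tree {0::nat} {}"
    by (auto simp: is_tree_def simple_graph_def connected_graph_def is_cycle_def)
       (metis Suc_le_lessD less_trans zero_less_Suc numeral_3_eq_3)
  then have "tree_decomposition V E {0} {} (\<lambda>_. V)"
    using assms by (auto simp: tree_decomposition_def simple_graph_def connected_graph_def)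
  then have "\<exists>w I F bag. tree_decomposition V E I F bag \<and> decomposition_width I bag = w" by blast
  then have "\<exists>I F bag. tree_decomposition V E I F bag \<and> decomposition_width I bag = treewidth V E"
    unfolding treewidth_def by (rule LeastI_ex)
  then obtain I F bag where td: "tree_decomposition V E I F bag" "decomposition_width I bag = treewidth V E"
    by blast
  have "finite I" using td(1) by (auto simp: tree_decomposition_def is_tree_def simple_graph_def)
  then have "card (bag i) \<le> Max ((\<lambda>i. card (bag i)) ` I)" if "i \<in> I" for i
    using that by auto
  then have "card (bag i) \<le> treewidth V E + 1" if "i \<in> I" for i
    using td(2) that unfolding decomposition_width_def by fastforce
  with td(1) that show ?thesis by blast
qed

lemma balanced_separator:
  assumes "simple_graph V E" "V \<noteq> {}" "C \<subseteq> V"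
  shows "\<exists>xs. set xs \<subseteq> V \<and> length xs \<le> treewidth V E + 1 \<and>
           (\<forall>y. y \<notin> set xs \<longrightarrow> 2 * card (C \<inter> reach E (set xs) `` {y}) \<le> card C)"
proof -
  obtain I F bag where td: "tree_decomposition V E I F bag"
    and w: "\<And>i. i \<in> I \<Longrightarrow> card (bag i) \<le> treewidth V E + 1"
    using treewidth_decomposition assms by blast
  obtain i where i: "i \<in> I" "\<And>y. y \<notin> bag i \<Longrightarrow> 2 * card (C \<inter> reach E (bag i) `` {y}) \<le> card C"
    using balanced_bag assms td by metis
  have sub: "bag i \<subseteq> V" using td i(1) unfolding tree_decomposition_def by blast
  then have "finite (bag i)" using assms(1) by (auto simp: simple_graph_def intro: finite_subset)
  then obtain xs where "set xs = bag i" "distinct xs" using finite_distinct_list by blast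
  then show ?thesis using sub i w[OF i(1)] distinct_card[of xs] by (intro exI[of _ xs]) auto
qed

section \<open>Infection chains\<close>

lemma infected_at_exists: "c u \<noteq> Uninfected \<Longrightarrow> \<exists>t. infected_at c u t"
  by (cases "c u") (auto simp: infected_at_def)

lemma infector_infected_earlier:
  assumes "infection_chain E lab \<delta> s t0 c" "c u = Infected t v"
  shows "{v, u} \<in> E" "\<exists>t'<t. infected_at c v t'"
proof -
  have "transmits E lab \<delta> c v u t" using assms unfolding infection_chain_def by blast
  then show "{v, u} \<in> E" "\<exists>t'<t. infected_at c v t'"
    unfolding transmits_def infectious_def by (auto simp: insert_commute Suc_le_eq)
qed

lemma source_seeded: "infection_chain E lab \<delta> s t0 c \<Longrightarrow> c u = Seeded t \<longleftrightarrow> u = s \<and> t = t0"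
  by (simp add: infection_chain_def)

lemma infected_before_separator_reach_source:
  assumes ch: "infection_chain E lab \<delta> s t0 c"
    and "infected_at c u t" "\<And>z t'. z \<in> S \<Longrightarrow> infected_at c z t' \<Longrightarrow> t < t'"
  shows "u \<notin> S \<and> (u, s) \<in> reach E S"
  using assms(2,3)
proof (induction t arbitrary: u rule: less_induct)
  case (less t)
  have uS: "u \<notin> S" using less.prems by blast
  show ?case
  proof (cases "c u")
    case (Seeded t1)
    then show ?thesis using uS source_seeded[OF ch] by simp
  next
    case (Infected t1 v)
    then have t1: "t1 = t" using less.prems(1) by (auto simp: infected_at_def)
    obtain t' where t': "t' < t" "infected_at c v t'" and e: "{v, u} \<in> E"
      using infector_infected_earlier[OF ch Infected] t1 by blast
    have "v \<notin> S \<and> (v, s) \<in> reach E S"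
      by (rule less.IH[OF t']) (use less.prems(2) t'(1) in fastforce)
    then show ?thesis
      using uS reach_trans[OF reach_edge[of u v]] e by (auto simp: insert_commute)
  qed (use less.prems in \<open>simp add: infected_at_def\<close>)
qed

section \<open>Decision trees\<close>

datatype 'a plan = Done 'a | Ask 'a "'a fate \<Rightarrow> 'a plan"

primrec plan_over :: "'a set \<Rightarrow> 'a plan \<Rightarrow> bool" where
  "plan_over V (Done v) \<longleftrightarrow> v \<in> V"
| "plan_over V (Ask v k) \<longleftrightarrow> v \<in> V \<and> (\<forall>f. plan_over V (k f))"

primrec plan_result :: "('a \<Rightarrow> 'a fate) \<Rightarrow> 'a plan \<Rightarrow> 'a" where
  "plan_result c (Done v) = v"
| "plan_result c (Ask v k) = plan_result c (k (c v))"

primrec plan_rounds :: "('a \<Rightarrow> 'a fate) \<Rightarrow> 'a plan \<Rightarrow> nat" where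
  "plan_rounds c (Done v) = 0"
| "plan_rounds c (Ask v k) = Suc (plan_rounds c (k (c v)))"

fun plan_after :: "'a plan \<Rightarrow> ('a \<times> 'a fate) list \<Rightarrow> 'a plan" where
  "plan_after (Ask v k) ((x, f) # h) = plan_after (k f) h"
| "plan_after p h = p"

definition plan_strategy :: "'a plan \<Rightarrow> 'a strategy" where
  "plan_strategy p h = (case plan_after p h of Done v \<Rightarrow> Name v | Ask v k \<Rightarrow> Watch v)"

lemma plan_after_Nil [simp]: "plan_after p [] = p"
  by (cases p) auto

lemma plan_after_Done [simp]: "plan_after (Done v) h = Done v"
  by (cases h) auto

lemma plan_over_after: "plan_over V p \<Longrightarrow> plan_over V (plan_after p h)"
  by (induction p h rule: plan_after.induct) auto

lemma legal_plan_strategy: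
  assumes "plan_over V p" shows "legal_strategy V (plan_strategy p)"
  unfolding legal_strategy_def
proof
  fix h show "plan_strategy p h \<in> Watch ` V \<union> Name ` V"
    using plan_over_after[OF assms, of h] by (auto simp: plan_strategy_def split: plan.split)
qed

lemma plan_strategy_Cons [simp]: "plan_strategy (Ask v k) ((x, f) # h) = plan_strategy (k f) h"
  by (simp add: plan_strategy_def)

lemma history_Ask:
  "history c (plan_strategy (Ask v k)) (Suc r) = (v, c v) # history c (plan_strategy (k (c v))) r"
proof (induction r)
  case 0
  then show ?case by (simp add: plan_strategy_def)
next
  case (Suc r)
  show ?case
    unfolding history.simps(2)[of c _ "Suc r"] Suc.IH by (simp split: action.split)
qed

lemma plan_strategy_history_Ask:
  "plan_strategy (Ask v k) (history c (plan_strategy (Ask v k)) (Suc r)) =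
     plan_strategy (k (c v)) (history c (plan_strategy (k (c v))) r)"
  by (simp only: history_Ask plan_strategy_Cons)

lemma plan_wins: "plan_result c p = s \<Longrightarrow> wins c s (plan_strategy p)"
proof (induction p)
  case (Done v)
  then show ?case by (auto simp: wins_def plan_strategy_def)
next
  case (Ask v k)
  then have "wins c s (plan_strategy (k (c v)))" by auto
  then show ?case unfolding wins_def using plan_strategy_history_Ask by metis
qed

lemma plan_watches_iff:
  "(\<exists>v. plan_strategy p (history c (plan_strategy p) r) = Watch v) \<longleftrightarrow> r < plan_rounds c p"
proof (induction p arbitrary: r)
  case (Done v)
  then show ?case by (auto simp: plan_strategy_def)
next
  case (Ask v k)
  show ?case
  proof (cases r)
    case 0
    then show ?thesis by (simp add: plan_strategy_def)
  next
    case (Suc r')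
    then show ?thesis
      using Ask[of "k (c v)" r'] plan_strategy_history_Ask[of v k c r'] by simp
  qed
qed

lemma plan_tolerated_infections:
  "tolerated_infections V c (plan_strategy p) = of_nat (card (infected_nodes V c)) * of_nat (plan_rounds c p)"
proof -
  have "tolerated_infections V c (plan_strategy p) =
      (\<Sum>r<plan_rounds c p. of_nat (card (infected_nodes V c)))"
    unfolding tolerated_infections_def plan_watches_iff
    by (subst suminf_finite[of "{..<plan_rounds c p}"]) auto
  then show ?thesis by (simp add: mult.commute)
qed

primrec ask_all :: "'a list \<Rightarrow> ('a \<Rightarrow> 'a fate) \<Rightarrow> (('a \<Rightarrow> 'a fate) \<Rightarrow> 'a plan) \<Rightarrow> 'a plan" where
  "ask_all [] b k = k b"
| "ask_all (x # xs) b k = Ask x (\<lambda>f. ask_all xs (b(x := f)) k)"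

lemma override_on_fun_upd: "override_on (b(x := c x)) c A = override_on b c (insert x A)"
  by (auto simp: override_on_def fun_eq_iff)

lemma ask_all_result:
  "plan_result c (ask_all xs b k) = plan_result c (k (override_on b c (set xs)))"
  by (induction xs arbitrary: b) (auto simp: override_on_fun_upd)

lemma ask_all_rounds:
  "plan_rounds c (ask_all xs b k) = length xs + plan_rounds c (k (override_on b c (set xs)))"
  by (induction xs arbitrary: b) (auto simp: override_on_fun_upd)

lemma ask_all_over:
  assumes "set xs \<subseteq> V" "\<And>b'. (\<forall>x. x \<notin> set xs \<longrightarrow> b' x = b x) \<Longrightarrow> plan_over V (k b')"
  shows "plan_over V (ask_all xs b k)"
  using assms by (induction xs arbitrary: b) auto

section \<open>Locating the source by separators\<close>

text \<open>The function \<open>b\<close> holds the fates observed on a separator, and \<open>w\<close> is a node known to be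
  infected. The result lies in the same component of the complement of the separator as the source.\<close>

definition suspect :: "'a \<Rightarrow> ('a \<Rightarrow> 'a fate) \<Rightarrow> 'a" where
  "suspect w b = (if \<forall>v. b v = Uninfected then w
     else SOME x. \<exists>v t. b v = Infected t x \<and> (\<forall>z t'. infected_at b z t' \<longrightarrow> t \<le> t'))"

lemma suspect_reaches_source:
  assumes ch: "infection_chain E lab \<delta> s t0 c" and w: "c w \<noteq> Uninfected" and s: "s \<notin> S"
  defines "b \<equiv> override_on (\<lambda>_. Uninfected) c S"
  shows "suspect w b \<notin> S \<and> (suspect w b, s) \<in> reach E S"
proof (cases "\<forall>v. b v = Uninfected")
  case True
  then have "\<not> infected_at c z t" if "z \<in> S" for z t
    using that by (auto simp: b_def infected_at_def dest!: spec[of _ z])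
  then show ?thesis
    using infected_before_separator_reach_source[OF ch] infected_at_exists[of c w] w True
    by (metis suspect_def)
next
  case False
  have iff: "infected_at b z t \<longleftrightarrow> z \<in> S \<and> infected_at c z t" for z t
    by (cases "z \<in> S") (auto simp: b_def infected_at_def)
  define t where "t = (LEAST t. \<exists>z. infected_at b z t)"
  have "\<exists>t z. infected_at b z t" using False infected_at_exists[of b] by blast
  then have "\<exists>z. infected_at b z t" unfolding t_def by (rule LeastI_ex)
  then obtain z where z: "infected_at b z t" by blast
  have tmin: "t \<le> t'" if "infected_at b z' t'" for z' t'
    unfolding t_def by (rule Least_le) (use that in blast)
  have "z \<in> S" using z iff by blast
  then have "b z \<noteq> Seeded t" using s source_seeded[OF ch] by (auto simp: b_def)
  then obtain v where "b z = Infected t v" using z by (auto simp: infected_at_def)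
  then have "\<exists>x v t. b v = Infected t x \<and> (\<forall>z t'. infected_at b z t' \<longrightarrow> t \<le> t')"
    using tmin by blast
  from someI_ex[OF this] obtain v' t' where v': "b v' = Infected t' (suspect w b)"
    and least: "\<And>z t''. infected_at b z t'' \<Longrightarrow> t' \<le> t''"
    using False unfolding suspect_def by auto
  have "c v' = Infected t' (suspect w b)" using v' by (auto simp: b_def override_on_def split: if_splits)
  then obtain t1 where "t1 < t'" "infected_at c (suspect w b) t1"
    using infector_infected_earlier[OF ch] by blast
  moreover have "t1 < t''" if "z \<in> S" "infected_at c z t''" for z t''
    using least[of z t''] iff that \<open>t1 < t'\<close> by fastforce
  ultimately show ?thesis
    using infected_before_separator_reach_source[OF ch] by blast
qed

primrec locate :: "'a set set \<Rightarrow> ('a set \<Rightarrow> 'a list) \<Rightarrow> 'a \<Rightarrow> nat \<Rightarrow> 'a \<Rightarrow> 'a set \<Rightarrow> 'a plan" where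
  "locate E sep d 0 w C = Done d"
| "locate E sep d (Suc m) w C = ask_all (sep C) (\<lambda>_. Uninfected) (\<lambda>b.
     if \<exists>v t. b v = Seeded t then Done (SOME v. \<exists>t. b v = Seeded t)
     else locate E sep d m w (C \<inter> reach E (set (sep C)) `` {suspect w b}))"

lemma locate_over:
  assumes "d \<in> V" "\<And>C. C \<subseteq> V \<Longrightarrow> set (sep C) \<subseteq> V" "C \<subseteq> V"
  shows "plan_over V (locate E sep d m w C)"
  using assms(3)
proof (induction m arbitrary: C)
  case (Suc m)
  have "(SOME v. \<exists>t. b v = Seeded t) \<in> V"
    if "\<forall>x. x \<notin> set (sep C) \<longrightarrow> b x = Uninfected" "\<exists>v t. b v = Seeded t" for b :: "'a \<Rightarrow> 'a fate"
  proof -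
    from someI_ex[OF that(2)] have "(SOME v. \<exists>t. b v = Seeded t) \<in> set (sep C)"
      using that(1) by force
    then show ?thesis using assms(2) Suc.prems by blast
  qed
  moreover have "plan_over V (locate E sep d m w (C \<inter> A))" for A
    using Suc by blast
  ultimately show ?case
    using assms(2)[OF Suc.prems] by (auto intro!: ask_all_over)
qed (use assms in simp)

lemma locate_rounds:
  assumes "\<And>C. C \<subseteq> V \<Longrightarrow> length (sep C) \<le> l" "C \<subseteq> V"
  shows "plan_rounds c (locate E sep d m w C) \<le> m * l"
  using assms(2)
proof (induction m arbitrary: C)
  case (Suc m)
  have "plan_rounds c (locate E sep d m w (C \<inter> A)) \<le> m * l" for A
    using Suc by blast
  then show ?case
    using assms(1)[OF Suc.prems] by (auto simp: ask_all_rounds intro!: add_mono)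
qed simp

lemma locate_result:
  assumes ch: "infection_chain E lab \<delta> s t0 c" and w: "c w \<noteq> Uninfected"
    and bal: "\<And>C y. C \<subseteq> V \<Longrightarrow> y \<notin> set (sep C) \<Longrightarrow>
      2 * card (C \<inter> reach E (set (sep C)) `` {y}) \<le> card C"
    and "finite V" "C \<subseteq> V" "s \<in> C" "card C < 2 ^ m"
  shows "plan_result c (locate E sep d m w C) = s"
  using assms(5-)
proof (induction m arbitrary: C)
  case 0
  then show ?case using \<open>finite V\<close> by (auto dest: finite_subset)
next
  case (Suc m)
  let ?S = "set (sep C)"
  let ?b = "override_on (\<lambda>_. Uninfected) c ?S"
  have seeded: "?b v = Seeded t \<longleftrightarrow> v = s \<and> t = t0 \<and> s \<in> ?S" for v t
    using source_seeded[OF ch] by (auto simp: override_on_def)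
  show ?case
  proof (cases "s \<in> ?S")
    case True
    then show ?thesis by (simp add: ask_all_result seeded)
  next
    case False
    let ?C = "C \<inter> reach E ?S `` {suspect w ?b}"
    have y: "suspect w ?b \<notin> ?S" "(suspect w ?b, s) \<in> reach E ?S"
      using suspect_reaches_source[OF ch w False] by auto
    have "plan_result c (locate E sep d m w ?C) = s"
      using Suc.prems y(2) bal[OF Suc.prems(1) y(1)] by (intro Suc.IH) auto
    then show ?thesis by (simp add: ask_all_result seeded False)
  qed
qed

section \<open>Finding an infected node by sampling\<close>

primrec search :: "'a \<Rightarrow> ('a \<Rightarrow> 'a plan) \<Rightarrow> 'a list \<Rightarrow> 'a plan" where
  "search d k [] = Done d"
| "search d k (x # xs) = Ask x (\<lambda>f. if f = Uninfected then search d k xs else k x)"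

lemma search_over:
  assumes "d \<in> V" "\<And>x. x \<in> V \<Longrightarrow> plan_over V (k x)" "set xs \<subseteq> V"
  shows "plan_over V (search d k xs)"
  using assms by (induction xs) auto

lemma search_result:
  assumes "\<And>x. c x \<noteq> Uninfected \<Longrightarrow> plan_result c (k x) = s" "\<exists>x\<in>set xs. c x \<noteq> Uninfected"
  shows "plan_result c (search d k xs) = s"
  using assms(2) by (induction xs) (auto simp: assms(1))

lemma search_rounds:
  assumes "\<And>x. plan_rounds c (k x) \<le> l"
  shows "plan_rounds c (search d k xs) \<le> length xs + l"
proof (induction xs)
  case (Cons x xs)
  then show ?case using assms[of x] by auto
qed simp

lemma expected_search_rounds:
  fixes V :: "'a set"
  assumes "finite V" "V \<noteq> {}" "infected_nodes V c \<noteq> {}"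
    and l: "\<And>x. plan_rounds c (k x) \<le> l"
  defines "q \<equiv> real (card (infected_nodes V c)) / real (card V)"
  shows "(\<integral>\<^sup>+xs. of_nat (plan_rounds c (search d k (xs @ ys))) \<partial>replicate_pmf m (pmf_of_set V))
    \<le> ennreal (1 / q + (1 - q) ^ m * real (length ys) + real l)"
proof (induction m)
  case 0
  have "q \<ge> 0" by (simp add: q_def)
  have "real (plan_rounds c (search d k ys)) \<le> real (length ys) + real l"
    using search_rounds[of c k l d ys] l by (simp flip: of_nat_add)
  also have "\<dots> \<le> 1 / q + real (length ys) + real l"
    using \<open>q \<ge> 0\<close> by simp
  finally show ?case
    by (simp add: ennreal_of_nat_eq_real_of_nat ennreal_leI)
next
  case (Suc m)
  let ?I = "infected_nodes V c"
  let ?B = "1 / q + (1 - q) ^ m * real (length ys) + real l"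
  have IV: "?I \<subseteq> V" by (auto simp: infected_nodes_def)
  then have finI: "finite ?I" using assms(1) finite_subset by blast
  have k: "card ?I > 0" "card V > 0" "card ?I \<le> card V"
    using assms(1-3) IV finI by (auto simp: card_gt_0_iff intro: card_mono)
  then have q: "0 < q" "q \<le> 1" by (auto simp: q_def)
  have B: "?B \<ge> 0" using q by simp
  have inner: "(\<integral>\<^sup>+xs. of_nat (plan_rounds c (search d k (x # xs @ ys))) \<partial>replicate_pmf m (pmf_of_set V))
      \<le> ennreal (1 + (if x \<in> ?I then real l else ?B))" if "x \<in> V" for x
  proof (cases "x \<in> ?I")
    case True
    then have "c x \<noteq> Uninfected" by (simp add: infected_nodes_def)
    then have "(\<integral>\<^sup>+xs. of_nat (plan_rounds c (search d k (x # xs @ ys))) \<partial>replicate_pmf m (pmf_of_set V))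
      = of_nat (Suc (plan_rounds c (k x)))"
      by simp
    also have "\<dots> = ennreal (real (Suc (plan_rounds c (k x))))"
      by (rule ennreal_of_nat_eq_real_of_nat)
    also have "\<dots> \<le> ennreal (1 + real l)" using l[of x] by (intro ennreal_leI) simp
    finally show ?thesis using True by simp
  next
    case False
    then have "c x = Uninfected" using that by (simp add: infected_nodes_def)
    then have "(\<integral>\<^sup>+xs. of_nat (plan_rounds c (search d k (x # xs @ ys))) \<partial>replicate_pmf m (pmf_of_set V))
      = 1 + (\<integral>\<^sup>+xs. of_nat (plan_rounds c (search d k (xs @ ys))) \<partial>replicate_pmf m (pmf_of_set V))"
      by (simp add: nn_integral_add)
    also have "\<dots> \<le> 1 + ennreal ?B" using Suc by (intro add_left_mono)
    also have "\<dots> = ennreal (1 + ?B)" using B by (simp add: ennreal_plus flip: ennreal_1)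
    finally show ?thesis using False by simp
  qed
  have "(\<integral>\<^sup>+xs. of_nat (plan_rounds c (search d k (xs @ ys))) \<partial>replicate_pmf (Suc m) (pmf_of_set V))
      = (\<integral>\<^sup>+x. \<integral>\<^sup>+xs. of_nat (plan_rounds c (search d k (x # xs @ ys)))
          \<partial>replicate_pmf m (pmf_of_set V) \<partial>pmf_of_set V)"
    by simp
  also have "\<dots> \<le> (\<integral>\<^sup>+x. ennreal (1 + (if x \<in> ?I then real l else ?B)) \<partial>pmf_of_set V)"
    by (intro nn_integral_mono_AE) (use inner assms(1,2) in \<open>auto simp: AE_measure_pmf_iff\<close>)
  also have "\<dots> = ennreal ((\<Sum>x\<in>V. 1 + (if x \<in> ?I then real l else ?B)) / card V)"
  proof -
    define g where "g x = 1 + (if x \<in> ?I then real l else ?B)" for x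
    have "g x \<ge> 0" for x using B by (simp add: g_def)
    then have "(\<integral>\<^sup>+x. ennreal (g x) \<partial>pmf_of_set V) = ennreal ((\<Sum>x\<in>V. g x) / card V)"
      using assms(1,2) k
      by (subst nn_integral_pmf_of_set)
         (simp_all add: sum_ennreal divide_ennreal sum_nonneg ennreal_of_nat_eq_real_of_nat)
    then show ?thesis by (simp only: g_def)
  qed
  also have "(\<Sum>x\<in>V. 1 + (if x \<in> ?I then real l else ?B)) =
      card V + (card ?I * real l + (real (card V) - card ?I) * ?B)"
  proof -
    have "V \<inter> {x. x \<in> ?I} = ?I" "V \<inter> - {x. x \<in> ?I} = V - ?I" using IV by auto
    moreover have "real (card (V - ?I)) = real (card V) - card ?I"
      using IV finI k by (simp add: card_Diff_subset of_nat_diff)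
    ultimately show ?thesis
      using assms(1) by (simp add: sum.distrib sum.If_cases)
  qed
  also have "\<dots> / card V = 1 + (q * real l + (1 - q) * ?B)"
  proof -
    have "(n + (q * n * r + (n - q * n) * b)) / n = 1 + (q * r + (1 - q) * b)" if "n > 0" for n r b :: real
      using that by (simp add: field_simps)
    moreover have "real (card ?I) = q * real (card V)" using k by (simp add: q_def)
    ultimately show ?thesis using k by simp
  qed
  also have "\<dots> = 1 / q + (1 - q) ^ Suc m * real (length ys) + real l"
  proof -
    have "(1 - q) * (1 / q) = 1 / q - 1" using q by (simp add: field_simps)
    moreover have "(1 - q) * ?B = (1 - q) * (1 / q) + (1 - q) ^ Suc m * real (length ys) + (1 - q) * real l"
      by (simp add: distrib_left mult.assoc)
    ultimately show ?thesis by (simp add: left_diff_distrib)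
  qed
  finally show ?case .
qed

lemma power_one_minus_le:
  fixes q :: real
  assumes "0 \<le> q" "q \<le> 1"
  shows "(1 - q) ^ n * (1 + n * q) \<le> 1"
proof -
  have "(1 - q) ^ n * (1 + n * q) \<le> (1 - q) ^ n * (1 + q) ^ n"
    using assms Bernoulli_inequality[of q n] by (intro mult_left_mono) auto
  also have "\<dots> = (1 - q\<^sup>2) ^ n"
    by (simp add: power2_eq_square algebra_simps flip: power_mult_distrib)
  also have "\<dots> \<le> 1"
    using assms by (intro power_le_one) (auto simp: power2_eq_square mult_le_one)
  finally show ?thesis .
qed

section \<open>The algorithm\<close>

definition separator :: "'a set \<Rightarrow> 'a set set \<Rightarrow> 'a set \<Rightarrow> 'a list" where
  "separator V E C = (SOME xs. set xs \<subseteq> V \<and> length xs \<le> treewidth V E + 1 \<and>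
     (\<forall>y. y \<notin> set xs \<longrightarrow> 2 * card (C \<inter> reach E (set xs) `` {y}) \<le> card C))"

definition detection_plan :: "'a set \<Rightarrow> 'a set set \<Rightarrow> 'a list \<Rightarrow> 'a plan" where
  "detection_plan V E xs =
     (let d = SOME v. v \<in> V
      in search d (\<lambda>w. locate E (separator V E) d (Suc (nat \<lfloor>log 2 (card V)\<rfloor>)) w V)
           (xs @ (SOME ys. set ys = V \<and> length ys = card V)))"

text \<open>Independent samples find an infected node quickly in expectation; the trailing enumeration
  of \<open>V\<close> makes the search succeed surely. A single node must be named without any
  round, as the bound is then \<open>0\<close>.\<close>

definition detection :: "'a set \<Rightarrow> 'a set set \<Rightarrow> 'a strategy pmf" where
  "detection V E =
     (if card V = 1 then return_pmf (plan_strategy (Done (SOME v. v \<in> V)))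
      else map_pmf (\<lambda>xs. plan_strategy (detection_plan V E xs)) (replicate_pmf (card V) (pmf_of_set V)))"

lemma separator:
  assumes "simple_graph V E" "V \<noteq> {}" "C \<subseteq> V"
  shows "set (separator V E C) \<subseteq> V" "length (separator V E C) \<le> treewidth V E + 1"
    "y \<notin> set (separator V E C) \<Longrightarrow> 2 * card (C \<inter> reach E (set (separator V E C)) `` {y}) \<le> card C"
  using someI_ex[OF balanced_separator[OF assms]] unfolding separator_def[symmetric] by auto

lemma enumeration:
  assumes "finite V"
  shows "set (SOME ys. set ys = V \<and> length ys = card V) = V"
    "length (SOME ys. set ys = V \<and> length ys = card V) = card V"
proof -
  have "\<exists>ys. set ys = V \<and> length ys = card V"
    using assms by (metis distinct_card finite_distinct_list)
  from someI_ex[OF this] show "set (SOME ys. set ys = V \<and> length ys = card V) = V"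
    "length (SOME ys. set ys = V \<and> length ys = card V) = card V" by auto
qed

lemma detection_plan_over:
  assumes "simple_graph V E" "V \<noteq> {}" "set xs \<subseteq> V"
  shows "plan_over V (detection_plan V E xs)"
proof -
  have "finite V" using assms by (simp add: simple_graph_def)
  moreover have "(SOME v. v \<in> V) \<in> V" using assms by (simp add: some_in_eq)
  ultimately show ?thesis
    unfolding detection_plan_def Let_def
    using assms separator(1)[OF assms(1,2)] enumeration(1)[OF \<open>finite V\<close>]
    by (intro search_over locate_over) auto
qed

lemma detection_plan_result:
  assumes "simple_graph V E" "s \<in> V" "infection_chain E lab \<delta> s t0 c"
  shows "plan_result c (detection_plan V E xs) = s"
proof -
  have fin: "finite V" using assms by (simp add: simple_graph_def)
  have ne: "V \<noteq> {}" using assms(2) by blast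
  let ?m = "Suc (nat \<lfloor>log 2 (card V)\<rfloor>)"
  have pos: "card V > 0" using fin ne by (simp add: card_gt_0_iff)
  have "real (card V) = 2 powr log 2 (card V)" using pos by simp
  also have "\<dots> < 2 powr real ?m" by (rule powr_less_mono) linarith+
  also have "\<dots> = real (2 ^ ?m)" by (subst powr_realpow) simp_all
  finally have m: "card V < 2 ^ ?m" by (simp only: of_nat_less_iff)
  have "c s \<noteq> Uninfected" using source_seeded[OF assms(3), of s t0] by simp
  then show ?thesis
    unfolding detection_plan_def Let_def
    using enumeration[OF fin] assms(2) m fin separator(3)[OF assms(1) ne]
    by (intro search_result locate_result[OF assms(3)]) auto
qed

lemma detection_legal:
  assumes "simple_graph V E" "V \<noteq> {}" "\<sigma> \<in> set_pmf (detection V E)"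
  shows "legal_strategy V \<sigma>"
proof (cases "card V = 1")
  case True
  then show ?thesis
    using assms by (simp add: detection_def some_in_eq legal_plan_strategy)
next
  case False
  have "finite V" using assms(1) by (simp add: simple_graph_def)
  then obtain xs where "\<sigma> = plan_strategy (detection_plan V E xs)" "set xs \<subseteq> V"
    using False assms(2,3) by (auto simp: detection_def set_replicate_pmf)
  then show ?thesis
    using assms by (simp add: legal_plan_strategy detection_plan_over)
qed

lemma detection_wins:
  assumes "simple_graph V E" "s \<in> V" "infection_chain E lab \<delta> s t0 c" "\<sigma> \<in> set_pmf (detection V E)"
  shows "wins c s \<sigma>"
proof (cases "card V = 1")
  case True
  then have "V = {s}" using assms(2) by (auto simp: card_1_singleton_iff)
  then show ?thesis
    using assms(4) by (simp add: detection_def plan_wins)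
next
  case False
  then obtain xs where "\<sigma> = plan_strategy (detection_plan V E xs)"
    using assms(4) by (auto simp: detection_def)
  then show ?thesis
    using detection_plan_result[OF assms(1-3)] by (simp add: plan_wins)
qed

lemma detection_bound_arith:
  fixes k n M L r w :: real
  assumes "1 \<le> k" "k \<le> n" "2 \<le> n" "0 \<le> w" "w \<le> M" "1 \<le> M" "0 \<le> r" "r * (1 + k) \<le> 1" "0 \<le> L" "L \<le> log 2 n + 1"
  shows "k * (n / k + r * n + L * (w + 1)) \<le> 9 * M * n * ln n"
proof -
  have ln2: "2 / 3 \<le> ln (2::real)" by (rule ln2_ge_two_thirds)
  have lnn: "ln 2 \<le> ln n" using assms by simp
  have lnn': "2 / 3 \<le> ln n" using ln2 lnn by (rule order_trans)
  have "log 2 n + 1 = (ln n + ln 2) / ln 2" using ln2 by (simp add: log_def field_simps)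
  also have "\<dots> \<le> 2 * ln n / (2 / 3)" using ln2 lnn by (intro frac_le) auto
  finally have L: "L \<le> 3 * ln n" using assms by simp
  have "k * r \<le> 1" using assms by (simp add: algebra_simps)
  then have "k * r * n \<le> n" using assms by (simp add: mult_right_le_one_le mult_left_le_one_le)
  moreover have "k * (n / k) = n" using assms by simp
  moreover have "k * (L * (w + 1)) \<le> n * ((3 * ln n) * (2 * M))"
    using assms L ln2 lnn by (intro mult_mono) (auto simp: mult_nonneg_nonneg)
  ultimately have "k * (n / k + r * n + L * (w + 1)) \<le> 2 * n + 6 * (M * n * ln n)"
    by (simp add: algebra_simps)
  also have "2 * n \<le> 3 * (M * n * ln n)"
  proof -
    have "1 * (2 / 3) \<le> M * ln n" using assms lnn' by (intro mult_mono) auto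
    then have "n * (2 / 3) \<le> n * (M * ln n)" using assms by (intro mult_left_mono) auto
    then show ?thesis by (simp add: algebra_simps)
  qed
  finally show ?thesis by simp
qed

lemma detection_expected_infections:
  assumes sg: "simple_graph V E" and s: "s \<in> V" and ch: "infection_chain E lab \<delta> s t0 c"
  shows "(\<integral>\<^sup>+\<sigma>. tolerated_infections V c \<sigma> \<partial>measure_pmf (detection V E))
    \<le> ennreal (9 * real (max 1 (treewidth V E)) * real (card V) * ln (real (card V)))"
proof (cases "card V = 1")
  case True
  then show ?thesis by (simp add: detection_def plan_tolerated_infections)
next
  case False
  have fin: "finite V" and ne: "V \<noteq> {}" using sg s by (auto simp: simple_graph_def)
  let ?I = "infected_nodes V c"
  let ?k = "card ?I" and ?n = "card V"
  let ?q = "real ?k / real ?n"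
  define m where "m = Suc (nat \<lfloor>log 2 ?n\<rfloor>)"
  let ?l = "m * (treewidth V E + 1)"
  define d where "d = (SOME v. v \<in> V)"
  define ys where "ys = (SOME ys. set ys = V \<and> length ys = card V)"
  define loc where "loc w = locate E (separator V E) d m w V" for w
  have "s \<in> ?I" using s source_seeded[OF ch, of s t0] by (simp add: infected_nodes_def)
  moreover have IV: "?I \<subseteq> V" by (auto simp: infected_nodes_def)
  ultimately have neI: "?I \<noteq> {}" and k: "1 \<le> ?k" "?k \<le> ?n"
    using fin by (auto simp: Suc_le_eq card_gt_0_iff dest: finite_subset intro: card_mono)
  then have n: "?n \<ge> 2" using False by linarith
  have loc: "plan_rounds c (loc w) \<le> ?l" for w
    unfolding loc_def using separator(2)[OF sg ne] by (intro locate_rounds) auto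
  have ys: "length ys = ?n" unfolding ys_def by (rule enumeration[OF fin])
  have q: "0 < ?q" "?q \<le> 1" using k by auto
  have "(\<integral>\<^sup>+\<sigma>. tolerated_infections V c \<sigma> \<partial>measure_pmf (detection V E)) =
      of_nat ?k * (\<integral>\<^sup>+xs. of_nat (plan_rounds c (search d loc (xs @ ys))) \<partial>replicate_pmf ?n (pmf_of_set V))"
    using False
    by (simp add: detection_def detection_plan_def plan_tolerated_infections nn_integral_cmult
        flip: d_def ys_def m_def loc_def)
  also have "\<dots> \<le> of_nat ?k * ennreal (1 / ?q + (1 - ?q) ^ ?n * real (length ys) + real ?l)"
    by (intro mult_left_mono expected_search_rounds fin ne neI loc) auto
  also have "\<dots> = ennreal (?k * (?n / ?k + (1 - ?q) ^ ?n * ?n + real m * (real (treewidth V E) + 1)))"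
    unfolding ennreal_of_nat_eq_real_of_nat
    by (subst ennreal_mult'[symmetric]) (simp_all add: ys algebra_simps)
  also have "\<dots> \<le> ennreal (9 * real (max 1 (treewidth V E)) * ?n * ln ?n)"
  proof (intro ennreal_leI detection_bound_arith)
    have "?n * ?q = ?k" using k n by simp
    then show "(1 - ?q) ^ ?n * (1 + real ?k) \<le> 1"
      using power_one_minus_le[of ?q ?n] q by simp
    have "log 2 ?n \<ge> 0" using n by simp
    then show "real m \<le> log 2 ?n + 1" unfolding m_def by linarith
  qed (use k n q in auto)
  finally show ?thesis .
qed

theorem theorem4:
  "\<exists>(Alg :: 'a set \<Rightarrow> 'a set set \<Rightarrow> nat \<Rightarrow> nat \<Rightarrow> 'a strategy pmf) (C :: real).
     \<forall>V E Tmax \<delta>. simple_graph V E \<and> V \<noteq> {} \<and> \<delta> \<ge> 1 \<longrightarrow>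
       (\<forall>\<sigma> \<in> set_pmf (Alg V E Tmax \<delta>). legal_strategy V \<sigma>) \<and>
       (\<forall>lab s t0 c.
          temporal_graph V E lab Tmax \<and> s \<in> V \<and> infection_chain E lab \<delta> s t0 c \<longrightarrow>
            (\<forall>\<sigma> \<in> set_pmf (Alg V E Tmax \<delta>). wins c s \<sigma>) \<and>
            (\<integral>\<^sup>+\<sigma>. tolerated_infections V c \<sigma> \<partial>measure_pmf (Alg V E Tmax \<delta>))
              \<le> ennreal (C * real (max 1 (treewidth V E)) * real (card V) * ln (real (card V))))"
proof (rule exI[of _ "\<lambda>V E _ _. detection V E"], rule exI[of _ 9], intro allI impI)
  fix V :: "'a set" and E :: "'a set set" and Tmax \<delta> :: nat
  assume V: "simple_graph V E \<and> V \<noteq> {} \<and> \<delta> \<ge> 1"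
  show "(\<forall>\<sigma> \<in> set_pmf (detection V E). legal_strategy V \<sigma>) \<and>
       (\<forall>lab s t0 c.
          temporal_graph V E lab Tmax \<and> s \<in> V \<and> infection_chain E lab \<delta> s t0 c \<longrightarrow>
            (\<forall>\<sigma> \<in> set_pmf (detection V E). wins c s \<sigma>) \<and>
            (\<integral>\<^sup>+\<sigma>. tolerated_infections V c \<sigma> \<partial>measure_pmf (detection V E))
              \<le> ennreal (9 * real (max 1 (treewidth V E)) * real (card V) * ln (real (card V))))"
  proof (intro conjI ballI allI impI)
    show "legal_strategy V \<sigma>" if "\<sigma> \<in> set_pmf (detection V E)" for \<sigma>
      using detection_legal V that by blast
  next
    fix lab s t0 c
    assume *: "temporal_graph V E lab Tmax \<and> s \<in> V \<and> infection_chain E lab \<delta> s t0 c"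
    show "wins c s \<sigma>" if "\<sigma> \<in> set_pmf (detection V E)" for \<sigma>
      using detection_wins[of V E s lab \<delta> t0 c] V * that by simp
    show "(\<integral>\<^sup>+\<sigma>. tolerated_infections V c \<sigma> \<partial>measure_pmf (detection V E))
        \<le> ennreal (9 * real (max 1 (treewidth V E)) * real (card V) * ln (real (card V)))"
      using detection_expected_infections[of V E s lab \<delta> t0 c] V * by simp
  qed
qed

end
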